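(* Assume $\langle V,\in\rangle$ satisfies ZFC. Suppose $\in^*$ is a class relation on $V$ definable in $\langle V,\in\rangle$ such that $\langle V,\in^*\rangle$ is a model of set theory (e.g. satisfies ZFC), and such that the induced inclusion relation $u\subseteq^* v\iff\forall a\,(a\in^* u\to a\in^* v)$ coincides with the usual inclusion relation $u\subseteq v\iff\forall a\,(a\in u\to a\in v)$. Then $\langle V,\in\rangle\cong\langle V,\in^*\rangle$. *)

theory Defs
  imports Main
begin

text \<open>
  Formulas of the first-order language of set theory. An assignment is total, so the values
  of the variables left free serve as parameters.
\<close>

datatype fm = Mem nat nat | Eq nat nat | Neg fm | Conj fm fm | All nat fm

primrec sat :: "('v \<Rightarrow> 'v \<Rightarrow> bool) \<Rightarrow> (nat \<Rightarrow> 'v) \<Rightarrow> fm \<Rightarrow> bool" where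
  "sat E s (Mem i j) \<longleftrightarrow> E (s i) (s j)"
| "sat E s (Eq i j) \<longleftrightarrow> s i = s j"
| "sat E s (Neg p) \<longleftrightarrow> \<not> sat E s p"
| "sat E s (Conj p q) \<longleftrightarrow> sat E s p \<and> sat E s q"
| "sat E s (All i p) \<longleftrightarrow> (\<forall>a. sat E (s(i := a)) p)"

text \<open>
  Classes are definable with parameters, given by the values of \<open>s\<close> at variables other
  than 0 and 1.
\<close>

definition definable_rel :: "('v \<Rightarrow> 'v \<Rightarrow> bool) \<Rightarrow> ('v \<Rightarrow> 'v \<Rightarrow> bool) \<Rightarrow> bool" where
  "definable_rel E R \<longleftrightarrow> (\<exists>p s. \<forall>x y. R x y \<longleftrightarrow> sat E (s(0 := x, 1 := y)) p)"

text \<open>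
  The axioms of ZFC, interpreted in the structure with universe \<open>'v\<close> and membership \<open>E\<close>.
  The two schemes range over first-order formulas with parameters only.
\<close>

definition ax_extensionality :: "('v \<Rightarrow> 'v \<Rightarrow> bool) \<Rightarrow> bool" where
  "ax_extensionality E \<longleftrightarrow> (\<forall>x y. (\<forall>z. E z x \<longleftrightarrow> E z y) \<longrightarrow> x = y)"

definition ax_foundation :: "('v \<Rightarrow> 'v \<Rightarrow> bool) \<Rightarrow> bool" where
  "ax_foundation E \<longleftrightarrow> (\<forall>a. (\<exists>x. E x a) \<longrightarrow> (\<exists>x. E x a \<and> \<not> (\<exists>y. E y x \<and> E y a)))"

definition ax_pairing :: "('v \<Rightarrow> 'v \<Rightarrow> bool) \<Rightarrow> bool" where
  "ax_pairing E \<longleftrightarrow> (\<forall>x y. \<exists>p. \<forall>z. E z p \<longleftrightarrow> z = x \<or> z = y)"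

definition ax_union :: "('v \<Rightarrow> 'v \<Rightarrow> bool) \<Rightarrow> bool" where
  "ax_union E \<longleftrightarrow> (\<forall>a. \<exists>u. \<forall>z. E z u \<longleftrightarrow> (\<exists>x. E x a \<and> E z x))"

definition ax_power :: "('v \<Rightarrow> 'v \<Rightarrow> bool) \<Rightarrow> bool" where
  "ax_power E \<longleftrightarrow> (\<forall>a. \<exists>p. \<forall>x. E x p \<longleftrightarrow> (\<forall>z. E z x \<longrightarrow> E z a))"

definition ax_infinity :: "('v \<Rightarrow> 'v \<Rightarrow> bool) \<Rightarrow> bool" where
  "ax_infinity E \<longleftrightarrow>
    (\<exists>w. (\<exists>e. E e w \<and> (\<forall>z. \<not> E z e)) \<and>
         (\<forall>x. E x w \<longrightarrow> (\<exists>y. E y w \<and> (\<forall>z. E z y \<longleftrightarrow> E z x \<or> z = x))))"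

definition ax_separation :: "('v \<Rightarrow> 'v \<Rightarrow> bool) \<Rightarrow> bool" where
  "ax_separation E \<longleftrightarrow>
    (\<forall>p s a. \<exists>b. \<forall>x. E x b \<longleftrightarrow> E x a \<and> sat E (s(0 := x)) p)"

definition ax_replacement :: "('v \<Rightarrow> 'v \<Rightarrow> bool) \<Rightarrow> bool" where
  "ax_replacement E \<longleftrightarrow>
    (\<forall>p s a. (\<forall>x. E x a \<longrightarrow> (\<exists>!y. sat E (s(0 := x, 1 := y)) p)) \<longrightarrow>
      (\<exists>b. \<forall>y. E y b \<longleftrightarrow> (\<exists>x. E x a \<and> sat E (s(0 := x, 1 := y)) p)))"

definition ax_choice :: "('v \<Rightarrow> 'v \<Rightarrow> bool) \<Rightarrow> bool" where
  "ax_choice E \<longleftrightarrow>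
    (\<forall>a. (\<forall>x. E x a \<longrightarrow> (\<exists>z. E z x)) \<and>
         (\<forall>x y. E x a \<and> E y a \<and> x \<noteq> y \<longrightarrow> \<not> (\<exists>z. E z x \<and> E z y)) \<longrightarrow>
      (\<exists>c. \<forall>x. E x a \<longrightarrow> (\<exists>!z. E z x \<and> E z c)))"

definition models_ZFC :: "('v \<Rightarrow> 'v \<Rightarrow> bool) \<Rightarrow> bool" where
  "models_ZFC E \<longleftrightarrow>
    ax_extensionality E \<and> ax_foundation E \<and> ax_pairing E \<and> ax_union E \<and> ax_power E \<and>
    ax_infinity E \<and> ax_separation E \<and> ax_replacement E \<and> ax_choice E"

definition inclusion :: "('v \<Rightarrow> 'v \<Rightarrow> bool) \<Rightarrow> 'v \<Rightarrow> 'v \<Rightarrow> bool" where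
  "inclusion E u v \<longleftrightarrow> (\<forall>a. E a u \<longrightarrow> E a v)"

definition isomorphic :: "('v \<Rightarrow> 'v \<Rightarrow> bool) \<Rightarrow> ('w \<Rightarrow> 'w \<Rightarrow> bool) \<Rightarrow> bool" where
  "isomorphic E F \<longleftrightarrow> (\<exists>f. bij f \<and> (\<forall>x y. E x y \<longleftrightarrow> F (f x) (f y)))"

end

theory Submission
  imports Defs
begin

text \<open>
  The singletons are the atoms of inclusion, so they are the same in both structures. Sending \<open>a\<close> to the
  element \<open>\<pi> a\<close> with \<open>{a} = {\<pi> a}\<^sup>*\<close> gives a definable permutation with \<open>a \<in> u \<longleftrightarrow> \<pi> a \<in>\<^sup>* u\<close>. By
  replacement along \<open>\<pi>\<close> and its inverse, both structures have the same collections as extensions of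
  sets. Hence, from the point of view of \<open>V\<close>, the relation \<open>\<in>\<^sup>*\<close> is set-like, extensional, well-founded
  (the foundation axiom for \<open>\<in>\<^sup>*\<close> speaks about all sets of \<open>V\<close>), and every set is the \<open>\<in>\<^sup>*\<close>-extension
  of some element. So the Mostowski collapse of \<open>\<in>\<^sup>*\<close> exists and is onto \<open>V\<close>. The collapse is
  obtained as the union of all set-sized bisimulations between the two relations, which makes its
  definability evident.
\<close>

section \<open>Renaming of variables and closure properties of first-order definability\<close>

primrec rename :: "(nat \<Rightarrow> nat) \<Rightarrow> fm \<Rightarrow> fm" where
  "rename f (Mem i j) = Mem (f i) (f j)"
| "rename f (Eq i j) = Eq (f i) (f j)"
| "rename f (Neg p) = Neg (rename f p)"
| "rename f (Conj p q) = Conj (rename f p) (rename f q)"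
| "rename f (All i p) = All (f i) (rename f p)"

text \<open>Injectivity of \<open>f\<close> makes the update at \<open>f i\<close> change
  \<open>s \<circ> f\<close> at \<open>i\<close> alone, so quantifiers commute with
  renaming.\<close>

lemma sat_rename:
  assumes "inj f"
  shows "sat E s (rename f p) \<longleftrightarrow> sat E (s \<circ> f) p"
proof (induction p arbitrary: s)
  case (All i p)
  have "s(f i := a) \<circ> f = (s \<circ> f)(i := a)" for a
    using assms by (auto simp: fun_eq_iff inj_eq)
  then show ?case by (simp add: All.IH del: fun_upd_apply comp_apply)
qed auto

definition interleave :: "(nat \<Rightarrow> 'v) \<Rightarrow> (nat \<Rightarrow> 'v) \<Rightarrow> nat \<Rightarrow> 'v" where
  "interleave s t i = (if even i then s (i div 2) else t (i div 2))"

lemma interleave_even [simp]: "interleave s t (2 * k) = s k"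
  by (simp add: interleave_def)

lemma interleave_odd [simp]: "interleave s t (Suc (2 * k)) = t k"
  by (simp add: interleave_def)

lemma parity_ext:
  fixes f g :: "nat \<Rightarrow> 'a"
  assumes "\<And>k. f (2 * k) = g (2 * k)" "\<And>k. f (Suc (2 * k)) = g (Suc (2 * k))"
  shows "f = g"
proof
  show "f i = g i" for i
    using assms by (cases "even i") (auto elim: evenE oddE)
qed

text \<open>
  The even variables carry the arguments and the odd ones the parameters; an infinite supply of
  odd variables makes room for fresh variables without any bookkeeping of free variables.
\<close>

definition fodef :: "('v \<Rightarrow> 'v \<Rightarrow> bool) \<Rightarrow> ((nat \<Rightarrow> 'v) \<Rightarrow> bool) \<Rightarrow> bool" where
  "fodef E P \<longleftrightarrow> (\<exists>p t. \<forall>s. P s \<longleftrightarrow> sat E (interleave s t) p)"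

lemma fodef_renameI:
  assumes "inj f" "\<And>s. P s \<longleftrightarrow> sat E (interleave s t \<circ> f) p"
  shows "fodef E P"
  unfolding fodef_def
  by (rule exI[of _ "rename f p"], rule exI[of _ t]) (simp add: assms sat_rename)

text \<open>The language has no function symbols, so the arguments of a relation are variables or
  constants used as parameters.\<close>

definition simple_term :: "((nat \<Rightarrow> 'v) \<Rightarrow> 'v) \<Rightarrow> bool" where
  "simple_term t \<longleftrightarrow> (\<exists>i. t = (\<lambda>s. s i)) \<or> (\<exists>c. t = (\<lambda>s. c))"

lemma simple_term_var: "simple_term (\<lambda>s. s i)"
  unfolding simple_term_def by auto

lemma simple_term_const: "simple_term (\<lambda>s. c)"
  unfolding simple_term_def by auto

lemma fodef_not:
  assumes "fodef E P"
  shows "fodef E (\<lambda>s. \<not> P s)"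
proof -
  obtain p t where "\<And>s. P s \<longleftrightarrow> sat E (interleave s t) p"
    using assms unfolding fodef_def by blast
  then show ?thesis
    unfolding fodef_def by (intro exI[of _ "Neg p"] exI[of _ t]) simp
qed

lemma fodef_conj:
  assumes "fodef E P" "fodef E Q"
  shows "fodef E (\<lambda>s. P s \<and> Q s)"
proof -
  obtain p t where p: "\<And>s. P s \<longleftrightarrow> sat E (interleave s t) p"
    using assms unfolding fodef_def by blast
  obtain q u where q: "\<And>s. Q s \<longleftrightarrow> sat E (interleave s u) q"
    using assms unfolding fodef_def by blast
  \<comment> \<open>Even variables stay put; odd ones go to the classes 1 and 3 modulo 4, so that
    \<open>interleave t u\<close> stores both parameter sequences.\<close>
  define f g :: "nat \<Rightarrow> nat" where
    "f = (\<lambda>i. if even i then i else 2 * i - 1)" and "g = (\<lambda>i. if even i then i else 2 * i + 1)"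
  have inj: "inj f" "inj g"
    by (rule injI, simp add: f_def split: if_splits; presburger)
      (rule injI, simp add: g_def split: if_splits; presburger)
  have fg: "f (2 * k) = 2 * k" "f (Suc (2 * k)) = Suc (2 * (2 * k))"
    "g (2 * k) = 2 * k" "g (Suc (2 * k)) = Suc (2 * Suc (2 * k))" for k
    by (simp_all add: f_def g_def)
  have f: "interleave s (interleave t u) \<circ> f = interleave s t"
    and g: "interleave s (interleave t u) \<circ> g = interleave s u" for s
    by (intro parity_ext; simp only: comp_apply fg interleave_even interleave_odd)+
  show ?thesis
    unfolding fodef_def
    by (intro exI[of _ "Conj (rename f p) (rename g q)"] exI[of _ "interleave t u"])
      (simp add: p q sat_rename inj f g)
qed

text \<open>
  With the bound variable in de Bruijn position 0, resolving against this rule leaves a goal in which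
  every variable is again of the form \<open>s i\<close>, so definability is proved by repeated introduction.
\<close>

lemma fodef_all:
  assumes "fodef E (\<lambda>s. Q (\<lambda>i. s (Suc i)) (s 0))"
  shows "fodef E (\<lambda>s. \<forall>a. Q s a)"
proof -
  obtain p t where p: "\<And>s. Q (\<lambda>i. s (Suc i)) (s 0) \<longleftrightarrow> sat E (interleave s t) p"
    using assms unfolding fodef_def by blast
  have p': "Q = (\<lambda>s a. sat E (interleave (case_nat a s) t) p)"
    using p[of "case_nat _ _"] by (simp add: fun_eq_iff)
  \<comment> \<open>Argument 0 moves to variable 1, which the quantifier will bind; the other
    arguments drop by one place and the parameters rise by one. The value of
    \<open>t (k - 1)\<close> at \<open>k = 0\<close> does not matter, since \<open>a\<close>
    overwrites it.\<close>
  define f :: "nat \<Rightarrow> nat" where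
    "f = (\<lambda>i. if i = 0 then 1 else if even i then i - 2 else i + 2)"
  have inj: "inj f"
    by (rule injI, simp add: f_def split: if_splits; presburger)
  have f: "(interleave s (\<lambda>k. t (k - 1)))(1 := a) \<circ> f = interleave (case_nat a s) t" for s a
  proof (rule parity_ext)
    show "((interleave s (\<lambda>k. t (k - 1)))(1 := a) \<circ> f) (2 * k) = interleave (case_nat a s) t (2 * k)" for k
      by (cases k) (auto simp: f_def interleave_def)
    have "f (Suc (2 * k)) = Suc (2 * Suc k)" for k
      by (simp add: f_def)
    then show "((interleave s (\<lambda>k. t (k - 1)))(1 := a) \<circ> f) (Suc (2 * k))
        = interleave (case_nat a s) t (Suc (2 * k))" for k
      by (simp del: mult_Suc_right)
  qed
  show ?thesis
    unfolding fodef_def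
    by (intro exI[of _ "All 1 (rename f p)"] exI[of _ "\<lambda>k. t (k - 1)"])
      (simp add: p' sat_rename inj f del: One_nat_def)
qed

lemma fodef_imp: "fodef E P \<Longrightarrow> fodef E Q \<Longrightarrow> fodef E (\<lambda>s. P s \<longrightarrow> Q s)"
  using fodef_not[OF fodef_conj[OF _ fodef_not], of E P Q] by simp

lemma fodef_disj: "fodef E P \<Longrightarrow> fodef E Q \<Longrightarrow> fodef E (\<lambda>s. P s \<or> Q s)"
  using fodef_imp[OF fodef_not, of E P Q] by (simp add: disj_imp)

lemma fodef_iff: "fodef E P \<Longrightarrow> fodef E Q \<Longrightarrow> fodef E (\<lambda>s. P s \<longleftrightarrow> Q s)"
  using fodef_conj[OF fodef_imp fodef_imp, of E P Q Q P] by (simp add: iff_conv_conj_imp)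

lemma fodef_ex:
  assumes "fodef E (\<lambda>s. Q (\<lambda>i. s (Suc i)) (s 0))"
  shows "fodef E (\<lambda>s. \<exists>a. Q s a)"
  using fodef_not[OF fodef_all[OF fodef_not[OF assms]]] by simp

lemma fodef_eq_var: "fodef E (\<lambda>s. s i = s j)"
  unfolding fodef_def
  by (intro exI[of _ "Eq (2 * i) (2 * j)"]) (simp add: interleave_def)

lemma fodef_eq_const: "fodef E (\<lambda>s. s i = c)"
  unfolding fodef_def
  by (intro exI[of _ "Eq (2 * i) 1"] exI[of _ "\<lambda>_. c"]) (simp add: interleave_def)

lemma fodef_True: "fodef E (\<lambda>s. True)"
  using fodef_eq_var[of E 0 0] by simp

lemma fodef_bool: "fodef E (\<lambda>s. b)"
  using fodef_True fodef_not[OF fodef_True] by (cases b) auto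

lemma fodef_eq:
  assumes "simple_term t" "simple_term u"
  shows "fodef E (\<lambda>s. t s = u s)"
proof -
  have "fodef E (\<lambda>s. c = s i)" for c i
    using fodef_eq_const[of E i c] by (simp only: eq_commute)
  then show ?thesis
    using assms unfolding simple_term_def by (auto simp: fodef_eq_var fodef_eq_const fodef_bool)
qed

lemma simple_term_shift: "simple_term t \<Longrightarrow> simple_term (\<lambda>s. t (\<lambda>i. s (Suc i)))"
  unfolding simple_term_def by auto

lemma fodef_subst2:
  assumes R: "fodef E (\<lambda>s. R (s 0) (s 1))" and "simple_term t" "simple_term u"
  shows "fodef E (\<lambda>s. R (t s) (u s))"
proof -
  \<comment> \<open>Equations on bound variables replace substitution into a formula; the order
    \<open>b a\<close> puts \<open>a\<close> in position 0 and \<open>b\<close> in position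
    1.\<close>
  have "fodef E (\<lambda>s. \<forall>b a. a = t s \<and> b = u s \<longrightarrow> R a b)"
    by (intro fodef_all fodef_imp fodef_conj fodef_eq simple_term_var
        simple_term_shift[OF simple_term_shift[OF assms(2)]]
        simple_term_shift[OF simple_term_shift[OF assms(3)]] R[unfolded One_nat_def])
  then show ?thesis by simp
qed

lemma fodef_mem:
  assumes "simple_term t" "simple_term u"
  shows "fodef E (\<lambda>s. E (t s) (u s))"
proof -
  have "fodef E (\<lambda>s. E (s 0) (s 1))"
    unfolding fodef_def by (intro exI[of _ "Mem 0 2"]) (simp add: interleave_def)
  then show ?thesis using assms by (rule fodef_subst2)
qed

lemma fodef_definable_rel:
  assumes "definable_rel E R"
  shows "fodef E (\<lambda>s. R (s 0) (s 1))"
proof -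
  obtain p s0 where p: "\<And>x y. R x y \<longleftrightarrow> sat E (s0(0 := x, 1 := y)) p"
    using assms unfolding definable_rel_def by blast
  \<comment> \<open>The two arguments go to the even variables 0 and 2, and every other
    \<open>i\<close> to the odd variable that holds \<open>s0 i\<close>.\<close>
  define f :: "nat \<Rightarrow> nat" where
    "f = (\<lambda>i. if i = 0 then 0 else if i = 1 then 2 else 2 * i + 1)"
  have inj: "inj f"
    by (rule injI, simp add: f_def split: if_splits; presburger)
  have "interleave s s0 \<circ> f = s0(0 := s 0, 1 := s 1)" for s
    by (auto simp: interleave_def f_def fun_eq_iff)
  then show ?thesis
    by (intro fodef_renameI[OF inj, of _ _ s0 p]) (simp only: p)
qed

lemmas fodef_intros = fodef_not fodef_conj fodef_disj fodef_imp fodef_iff fodef_all fodef_ex fodef_eq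
  fodef_mem simple_term_var simple_term_const

section \<open>Separation and replacement for definable predicates\<close>

lemma fodef_separation:
  assumes "ax_separation E" "fodef E (\<lambda>s. P (s 0))"
  obtains b where "\<And>x. E x b \<longleftrightarrow> E x a \<and> P x"
proof -
  obtain p t where p: "\<And>s. P (s 0) \<longleftrightarrow> sat E (interleave s t) p"
    using assms(2) unfolding fodef_def by blast
  define s where "s = interleave (\<lambda>_. a) t"
  have "interleave ((\<lambda>_. a)(0 := x)) t = s(0 := x)" for x
    by (rule parity_ext) (auto simp: s_def)
  then have "P x \<longleftrightarrow> sat E (s(0 := x)) p" for x
    using p[of "(\<lambda>_. a)(0 := x)"] by simp
  moreover obtain b where "\<And>x. E x b \<longleftrightarrow> E x a \<and> sat E (s(0 := x)) p"
    using assms(1) unfolding ax_separation_def by blast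
  ultimately show ?thesis using that by blast
qed

lemma fodef_replacement:
  assumes "ax_replacement E" "fodef E (\<lambda>s. R (s 0) (s 1))" "\<And>x. E x a \<Longrightarrow> \<exists>!y. R x y"
  obtains b where "\<And>y. E y b \<longleftrightarrow> (\<exists>x. E x a \<and> R x y)"
proof -
  obtain p t where p: "\<And>s. R (s 0) (s 1) \<longleftrightarrow> sat E (interleave s t) p"
    using assms(2) unfolding fodef_def by blast
  \<comment> \<open>The axiom reads the second argument at variable 1, while
    \<open>interleave\<close> keeps it at variable 2; hence the swap.\<close>
  define f :: "nat \<Rightarrow> nat" where "f = id(1 := 2, 2 := 1)"
  have inj: "inj f"
    unfolding f_def inj_def by auto
  define s where "s = interleave (\<lambda>_. a) t \<circ> f"
  have "interleave ((\<lambda>_. a)(0 := x, 1 := y)) t = s(0 := x, 1 := y) \<circ> f" for x y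
    by (auto simp: interleave_def s_def f_def fun_eq_iff)
  then have R: "R x y \<longleftrightarrow> sat E (s(0 := x, 1 := y)) (rename f p)" for x y
    using p[of "(\<lambda>_. a)(0 := x, 1 := y)"] by (simp add: sat_rename[OF inj])
  then have "\<exists>!y. sat E (s(0 := x, 1 := y)) (rename f p)" if "E x a" for x
    using assms(3)[OF that] by simp
  then obtain b where "\<And>y. E y b \<longleftrightarrow> (\<exists>x. E x a \<and> sat E (s(0 := x, 1 := y)) (rename f p))"
    using assms(1)[unfolded ax_replacement_def, THEN spec, THEN spec, THEN spec, THEN mp,
        of a s "rename f p"] by auto
  then show ?thesis by (intro that[of b]) (simp add: R)
qed

section \<open>Elementary set theory inside a model: pairs, relations, natural numbers\<close>

locale zfc_model =
  fixes E :: "'v \<Rightarrow> 'v \<Rightarrow> bool"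
  assumes models: "models_ZFC E"
begin

lemma set_ext: "(\<And>z. E z x \<longleftrightarrow> E z y) \<Longrightarrow> x = y"
  using models unfolding models_ZFC_def ax_extensionality_def by blast

lemma empty_set: "\<exists>e. \<forall>z. \<not> E z e"
  using models unfolding models_ZFC_def ax_infinity_def by blast

lemma pairing: "\<exists>p. \<forall>z. E z p \<longleftrightarrow> z = x \<or> z = y"
  using models unfolding models_ZFC_def ax_pairing_def by blast

lemma union: "\<exists>u. \<forall>z. E z u \<longleftrightarrow> (\<exists>x. E x a \<and> E z x)"
  using models unfolding models_ZFC_def ax_union_def by blast

lemma foundation:
  assumes "E x a"
  obtains y where "E y a" "\<And>z. E z y \<Longrightarrow> \<not> E z a"
  using models assms unfolding models_ZFC_def ax_foundation_def by blast

lemma separation: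
  assumes "fodef E (\<lambda>s. P (s 0))"
  shows "\<exists>b. \<forall>x. E x b \<longleftrightarrow> E x a \<and> P x"
  using fodef_separation[OF _ assms, of a] models unfolding models_ZFC_def by metis

abbreviation class_rel :: "('v \<Rightarrow> 'v \<Rightarrow> bool) \<Rightarrow> bool" where
  "class_rel R \<equiv> fodef E (\<lambda>s. R (s 0) (s 1))"

text \<open>The axiom asks for a value at every element of \<open>a\<close>; cutting
  \<open>a\<close> down to the domain \<open>d\<close> of \<open>R\<close> admits partial
  functions.\<close>

lemma replacement:
  assumes R: "class_rel R" and "\<And>x y y'. E x a \<Longrightarrow> R x y \<Longrightarrow> R x y' \<Longrightarrow> y = y'"
  shows "\<exists>b. \<forall>y. E y b \<longleftrightarrow> (\<exists>x. E x a \<and> R x y)"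
proof -
  have "fodef E (\<lambda>s. \<exists>y. R (s 0) y)"
    by (intro fodef_intros fodef_subst2[OF R])
  from separation[OF this, of a] obtain d where d: "\<And>x. E x d \<longleftrightarrow> E x a \<and> (\<exists>y. R x y)"
    by blast
  have "\<exists>!y. R x y" if "E x d" for x
    using that assms(2) unfolding d by blast
  moreover have "ax_replacement E"
    using models unfolding models_ZFC_def by blast
  ultimately obtain b where "\<And>y. E y b \<longleftrightarrow> (\<exists>x. E x d \<and> R x y)"
    using fodef_replacement[OF _ R] by metis
  then show ?thesis
    by (intro exI[of _ b]) (auto simp: d)
qed

lemma insert_set: "\<exists>c. \<forall>z. E z c \<longleftrightarrow> E z a \<or> z = b"
proof -
  obtain s where s: "\<And>z. E z s \<longleftrightarrow> z = b \<or> z = b" using pairing[of b b] by metis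
  obtain p where p: "\<And>z. E z p \<longleftrightarrow> z = a \<or> z = s" using pairing[of a s] by metis
  obtain c where "\<And>z. E z c \<longleftrightarrow> (\<exists>x. E x p \<and> E z x)" using union[of p] by blast
  then show ?thesis by (intro exI[of _ c]) (auto simp: p s)
qed

lemma mem_asym: "E a b \<Longrightarrow> \<not> E b a"
proof
  assume *: "E a b" "E b a"
  obtain p where p: "\<And>z. E z p \<longleftrightarrow> z = a \<or> z = b" using pairing[of a b] by metis
  obtain y where "E y p" "\<And>z. E z y \<Longrightarrow> \<not> E z p"
    using foundation[of a p] p by auto
  then show False using * unfolding p by blast
qed

definition is_upair :: "'v \<Rightarrow> 'v \<Rightarrow> 'v \<Rightarrow> bool" where
  "is_upair w a b \<longleftrightarrow> (\<forall>v. E v w \<longleftrightarrow> v = a \<or> v = b)"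

text \<open>The Kuratowski pair, as a predicate that unfolds to a formula in \<open>E\<close> on
  which \<open>fodef_intros\<close> works.\<close>

definition is_pair :: "'v \<Rightarrow> 'v \<Rightarrow> 'v \<Rightarrow> bool" where
  "is_pair z a b \<longleftrightarrow> (\<forall>w. E w z \<longleftrightarrow> is_upair w a a \<or> is_upair w a b)"

definition in_rel :: "'v \<Rightarrow> 'v \<Rightarrow> 'v \<Rightarrow> bool" where
  "in_rel r a b \<longleftrightarrow> (\<exists>z. E z r \<and> is_pair z a b)"

lemma is_upair_exists: "\<exists>w. is_upair w a b"
  unfolding is_upair_def using pairing by metis

lemma is_upair_unique: "is_upair w a b \<Longrightarrow> is_upair w' a b \<Longrightarrow> w = w'"
  unfolding is_upair_def by (rule set_ext) blast

lemma is_pair_exists: "\<exists>z. is_pair z a b"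
proof -
  obtain s t where st: "is_upair s a a" "is_upair t a b" using is_upair_exists by metis
  obtain z where "\<And>w. E w z \<longleftrightarrow> w = s \<or> w = t" using pairing[of s t] by metis
  then show ?thesis
    unfolding is_pair_def using st is_upair_unique by metis
qed

lemma is_pair_unique: "is_pair z a b \<Longrightarrow> is_pair z' a b \<Longrightarrow> z = z'"
  unfolding is_pair_def by (rule set_ext) blast

lemma is_pair_inject:
  assumes "is_pair z a b" "is_pair z c d"
  shows "a = c \<and> b = d"
proof -
  obtain s t u where st: "is_upair s a a" "is_upair t a b" "is_upair u c d"
    using is_upair_exists by metis
  have "is_upair s c c \<or> is_upair s c d" "is_upair t c c \<or> is_upair t c d"
    "is_upair u a a \<or> is_upair u a b"
    using assms st unfolding is_pair_def by blast+
  then show ?thesis using st unfolding is_upair_def by metis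
qed

text \<open>Replacement along the map from \<open>a\<close> to the pair of \<open>a\<close> and its
  \<open>N\<close>-value. This turns a functional class on a set into a set.\<close>

lemma in_rel_graph:
  assumes N: "class_rel N" and "\<And>a b b'. E a u \<Longrightarrow> N a b \<Longrightarrow> N a b' \<Longrightarrow> b = b'"
  shows "\<exists>r. \<forall>a b. in_rel r a b \<longleftrightarrow> E a u \<and> N a b"
proof -
  have "class_rel (\<lambda>a z. \<exists>b. is_pair z a b \<and> N a b)"
    unfolding is_pair_def is_upair_def by (intro fodef_intros fodef_subst2[OF N])
  from replacement[OF this, of u] obtain r where "\<And>z. E z r \<longleftrightarrow> (\<exists>a. E a u \<and> (\<exists>b. is_pair z a b \<and> N a b))"
    using assms(2) is_pair_unique by metis
  then have "in_rel r a b \<longleftrightarrow> E a u \<and> N a b" for a b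
    unfolding in_rel_def using is_pair_exists[of a b] is_pair_inject by metis
  then show ?thesis by blast
qed

lemma in_rel_insert:
  "\<exists>r'. \<forall>a b. in_rel r' a b \<longleftrightarrow> in_rel r a b \<or> a = x \<and> b = y"
proof -
  obtain p where p: "is_pair p x y" using is_pair_exists by blast
  obtain r' where "\<And>z. E z r' \<longleftrightarrow> E z r \<or> z = p" using insert_set[of r p] by blast
  then have "in_rel r' a b \<longleftrightarrow> in_rel r a b \<or> a = x \<and> b = y" for a b
    unfolding in_rel_def using p is_pair_inject by metis
  then show ?thesis by blast
qed

definition is_zero :: "'v \<Rightarrow> bool" where
  "is_zero e \<longleftrightarrow> (\<forall>z. \<not> E z e)"

definition is_succ :: "'v \<Rightarrow> 'v \<Rightarrow> bool" where
  "is_succ m n \<longleftrightarrow> (\<forall>z. E z n \<longleftrightarrow> E z m \<or> z = m)"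

definition is_inductive :: "'v \<Rightarrow> bool" where
  "is_inductive w \<longleftrightarrow> (\<forall>e. is_zero e \<longrightarrow> E e w) \<and> (\<forall>m n. E m w \<longrightarrow> is_succ m n \<longrightarrow> E n w)"

lemma is_zero_unique: "is_zero d \<Longrightarrow> is_zero e \<Longrightarrow> d = e"
  unfolding is_zero_def by (rule set_ext) blast

lemma is_succ_unique: "is_succ m n \<Longrightarrow> is_succ m n' \<Longrightarrow> n = n'"
  unfolding is_succ_def by (rule set_ext) blast

lemma is_succ_exists: "\<exists>n. is_succ m n"
  unfolding is_succ_def using insert_set[of m m] by metis

text \<open>If \<open>m\<close> and \<open>m'\<close> differed, each would be an element of the
  other.\<close>

lemma is_succ_inject: "is_succ m n \<Longrightarrow> is_succ m' n \<Longrightarrow> m = m'"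
  unfolding is_succ_def using mem_asym by metis

lemma is_succ_not_zero: "is_succ m n \<Longrightarrow> \<not> is_zero n"
  unfolding is_succ_def is_zero_def by blast

text \<open>Take for \<open>w\<close> the intersection of all inductive sets. Induction is limited
  to definable \<open>P\<close> because it separates an inductive subset of
  \<open>w\<close>.\<close>

lemma omega:
  obtains w where "is_inductive w"
    "\<And>P n. fodef E (\<lambda>s. P (s 0)) \<Longrightarrow> (\<And>e. is_zero e \<Longrightarrow> P e) \<Longrightarrow>
      (\<And>m n. P m \<Longrightarrow> is_succ m n \<Longrightarrow> P n) \<Longrightarrow> E n w \<Longrightarrow> P n"
proof -
  obtain w0 where "\<exists>e. E e w0 \<and> (\<forall>z. \<not> E z e)"
    "\<forall>x. E x w0 \<longrightarrow> (\<exists>y. E y w0 \<and> (\<forall>z. E z y \<longleftrightarrow> E z x \<or> z = x))"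
    using models unfolding models_ZFC_def ax_infinity_def by blast
  then have w0: "is_inductive w0"
    unfolding is_inductive_def
    using is_zero_unique is_succ_unique by (metis is_zero_def is_succ_def)
  have "fodef E (\<lambda>s. \<forall>v. is_inductive v \<longrightarrow> E (s 0) v)"
    unfolding is_inductive_def is_zero_def is_succ_def by (intro fodef_intros)
  from separation[OF this, of w0] obtain w where w: "\<And>n. E n w \<longleftrightarrow> E n w0 \<and> (\<forall>v. is_inductive v \<longrightarrow> E n v)"
    by blast
  have "is_inductive w"
    using w0 unfolding is_inductive_def w by blast
  moreover have "P n"
    if P: "fodef E (\<lambda>s. P (s 0))" "\<And>e. is_zero e \<Longrightarrow> P e" "\<And>m n. P m \<Longrightarrow> is_succ m n \<Longrightarrow> P n"
      and "E n w" for P n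
  proof -
    obtain v where v: "\<And>x. E x v \<longleftrightarrow> E x w \<and> P x"
      using separation[OF P(1), of w] by blast
    have "is_inductive v"
      using \<open>is_inductive w\<close> P(2,3) unfolding is_inductive_def v by blast
    then show ?thesis using \<open>E n w\<close> unfolding w using v by blast
  qed
  ultimately show ?thesis by (rule that)
qed

end

section \<open>Induction along set-like well-founded class relations\<close>

locale set_like_rel = zfc_model E for E :: "'v \<Rightarrow> 'v \<Rightarrow> bool" +
  fixes R :: "'v \<Rightarrow> 'v \<Rightarrow> bool"
  assumes rel: "class_rel R"
    and set_like: "\<exists>A. \<forall>a. E a A \<longleftrightarrow> R a x"
    and founded: "E x A \<Longrightarrow> \<exists>y. E y A \<and> (\<forall>z. R z y \<longrightarrow> \<not> E z A)"
begin

lemmas rel_intros = fodef_intros fodef_subst2[OF rel]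

definition is_preds :: "'v \<Rightarrow> 'v \<Rightarrow> bool" where
  "is_preds X Y \<longleftrightarrow> (\<forall>z. E z Y \<longleftrightarrow> (\<exists>y. E y X \<and> R z y))"

lemma is_preds_unique: "is_preds X Y \<Longrightarrow> is_preds X Y' \<Longrightarrow> Y = Y'"
  unfolding is_preds_def by (rule set_ext) blast

text \<open>Replacement collects the \<open>R\<close>-extensions of the elements of
  \<open>X\<close>, and their union is \<open>Y\<close>.\<close>

lemma is_preds_exists: "\<exists>Y. is_preds X Y"
proof -
  have "class_rel (\<lambda>y A. \<forall>z. E z A \<longleftrightarrow> R z y)"
    by (intro rel_intros)
  from replacement[OF this, of X] obtain B where B: "\<And>A. E A B \<longleftrightarrow> (\<exists>y. E y X \<and> (\<forall>z. E z A \<longleftrightarrow> R z y))"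
    using set_ext by metis
  obtain Y where Y: "\<And>z. E z Y \<longleftrightarrow> (\<exists>A. E A B \<and> E z A)" using union[of B] by blast
  have "is_preds X Y"
    unfolding is_preds_def Y B using set_like by metis
  then show ?thesis ..
qed

text \<open>
  The \<open>n\<close>-th iterate of \<open>is_preds\<close> on \<open>{x}\<close>, by recursion along the possibly nonstandard \<open>\<omega>\<close> of the
  model; the witness \<open>r\<close> is a partial computation closed under going back to predecessors.
\<close>

definition level :: "'v \<Rightarrow> 'v \<Rightarrow> 'v \<Rightarrow> bool" where
  "level x n X \<longleftrightarrow> (\<exists>r. in_rel r n X \<and>
    (\<forall>m Y. in_rel r m Y \<longrightarrow> is_zero m \<and> is_upair Y x x \<or>
      (\<exists>k Z. is_succ k m \<and> is_preds Z Y \<and> in_rel r k Z)))"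

lemma class_rel_level: "class_rel (level x)"
  unfolding level_def in_rel_def is_pair_def is_upair_def is_zero_def is_succ_def is_preds_def
  by (intro rel_intros)

lemma level_cases:
  assumes "level x m Y"
  obtains "is_zero m" "is_upair Y x x"
  | k Z where "is_succ k m" "is_preds Z Y" "level x k Z"
  using assms unfolding level_def by metis

lemma level_zero:
  assumes "is_zero m" "is_upair Y x x"
  shows "level x m Y"
proof -
  obtain e where e: "\<And>z. \<not> E z e" using empty_set by blast
  obtain r where r: "\<And>a b. in_rel r a b \<longleftrightarrow> in_rel e a b \<or> a = m \<and> b = Y"
    using in_rel_insert[of e m Y] by blast
  have "\<not> in_rel e a b" for a b using e unfolding in_rel_def by blast
  then show ?thesis
    unfolding level_def by (intro exI[of _ r]) (simp add: r assms)
qed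

text \<open>Adding the pair of \<open>m\<close> and \<open>Y\<close> to a computation that contains
  \<open>k\<close> and \<open>Z\<close> keeps every entry justified.\<close>

lemma level_succ:
  assumes "level x k Z" "is_succ k m" "is_preds Z Y"
  shows "level x m Y"
proof -
  obtain r where r: "in_rel r k Z" "\<And>m Y. in_rel r m Y \<Longrightarrow> is_zero m \<and> is_upair Y x x \<or>
      (\<exists>k Z. is_succ k m \<and> is_preds Z Y \<and> in_rel r k Z)"
    using assms(1) unfolding level_def by blast
  obtain r' where r': "\<And>a b. in_rel r' a b \<longleftrightarrow> in_rel r a b \<or> a = m \<and> b = Y"
    using in_rel_insert[of r m Y] by blast
  show ?thesis
    unfolding level_def
    by (intro exI[of _ r'], unfold r') (use r assms(2,3) in blast)
qed

text \<open>Take for \<open>T\<close> the union of the levels of \<open>x\<close> over all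
  \<open>n\<close> in omega.\<close>

lemma closed_superset:
  obtains T where "E x T" "\<And>y z. E y T \<Longrightarrow> R z y \<Longrightarrow> E z T"
proof -
  obtain w where w: "is_inductive w" and induct:
    "\<And>P n. fodef E (\<lambda>s. P (s 0)) \<Longrightarrow> (\<And>e. is_zero e \<Longrightarrow> P e) \<Longrightarrow>
      (\<And>m n. P m \<Longrightarrow> is_succ m n \<Longrightarrow> P n) \<Longrightarrow> E n w \<Longrightarrow> P n"
    by (rule omega) blast
  \<comment> \<open>Levels are unique by induction on \<open>n\<close>, which lets replacement
    collect them in \<open>B\<close>.\<close>
  have "fodef E (\<lambda>s. \<forall>X Y. level x (s 0) X \<longrightarrow> level x (s 0) Y \<longrightarrow> X = Y)"
    by (intro rel_intros fodef_subst2[OF class_rel_level])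
  then have "\<forall>X Y. level x n X \<longrightarrow> level x n Y \<longrightarrow> X = Y" if "E n w" for n
  proof (rule induct)
    show "\<forall>X Y. level x e X \<longrightarrow> level x e Y \<longrightarrow> X = Y" if "is_zero e" for e
      using that is_succ_not_zero is_upair_unique by (metis level_cases)
    show "\<forall>X Y. level x n X \<longrightarrow> level x n Y \<longrightarrow> X = Y"
      if "\<forall>X Y. level x m X \<longrightarrow> level x m Y \<longrightarrow> X = Y" "is_succ m n" for m n
      using that is_succ_not_zero is_succ_inject is_preds_unique by (metis level_cases)
  qed (rule that)
  then obtain B where B: "\<And>X. E X B \<longleftrightarrow> (\<exists>n. E n w \<and> level x n X)"
    using replacement[OF class_rel_level, of w x] by metis
  obtain T where T: "\<And>z. E z T \<longleftrightarrow> (\<exists>X. E X B \<and> E z X)" using union[of B] by blast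
  show ?thesis
  proof
    obtain e X where "is_zero e" "is_upair X x x"
      using empty_set is_upair_exists unfolding is_zero_def by metis
    moreover from this have "E e w" using w unfolding is_inductive_def by blast
    ultimately show "E x T"
      unfolding T B using level_zero is_upair_def by metis
    fix y z assume "E y T" "R z y"
    then obtain n X where X: "E n w" "level x n X" "E y X"
      unfolding T B by blast
    obtain m Y where mY: "is_succ n m" "is_preds X Y"
      using is_succ_exists is_preds_exists by metis
    have "E m w" using X(1) mY(1) w unfolding is_inductive_def by blast
    moreover have "level x m Y" using X(2) mY by (rule level_succ)
    moreover have "E z Y" using X(3) mY(2) \<open>R z y\<close> unfolding is_preds_def by blast
    ultimately show "E z T" unfolding T B by blast
  qed
qed

text \<open>Counterexamples may form a proper class, while \<open>founded\<close> concerns sets.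
  Those in a closed \<open>T\<close> form a set \<open>A\<close>; the predecessors of a minimal
  element of \<open>A\<close> stay in \<open>T\<close>, so they satisfy \<open>P\<close>.\<close>

lemma class_induct:
  assumes P: "fodef E (\<lambda>s. P (s 0))" and step: "\<And>x. (\<And>y. R y x \<Longrightarrow> P y) \<Longrightarrow> P x"
  shows "P x"
proof (rule ccontr)
  assume "\<not> P x"
  obtain T where T: "E x T" "\<And>y z. E y T \<Longrightarrow> R z y \<Longrightarrow> E z T"
    using closed_superset by blast
  have "fodef E (\<lambda>s. \<not> P (s 0))"
    using P by (rule fodef_not)
  from separation[OF this, of T] obtain A where A: "\<And>y. E y A \<longleftrightarrow> E y T \<and> \<not> P y"
    by blast
  obtain y where "E y A" "\<And>z. R z y \<Longrightarrow> \<not> E z A"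
    using founded[of x A] A T(1) \<open>\<not> P x\<close> by blast
  then show False using A T(2) step by blast
qed

end

section \<open>Bisimulations and the isomorphism between two universes over one model\<close>

locale universe_rel = set_like_rel +
  assumes rel_ext: "(\<And>z. R z x \<longleftrightarrow> R z y) \<Longrightarrow> x = y"
    and represented: "\<exists>x. \<forall>a. R a x \<longleftrightarrow> E a A"

definition bisim :: "('a \<Rightarrow> 'a \<Rightarrow> bool) \<Rightarrow> ('b \<Rightarrow> 'b \<Rightarrow> bool) \<Rightarrow> ('a \<Rightarrow> 'b \<Rightarrow> bool) \<Rightarrow> bool" where
  "bisim R S N \<longleftrightarrow> (\<forall>a b. N a b \<longrightarrow>
    (\<forall>a'. R a' a \<longrightarrow> (\<exists>b'. S b' b \<and> N a' b')) \<and> (\<forall>b'. S b' b \<longrightarrow> (\<exists>a'. R a' a \<and> N a' b')))"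

lemma bisim_forth: "bisim R S N \<Longrightarrow> N a b \<Longrightarrow> R a' a \<Longrightarrow> \<exists>b'. S b' b \<and> N a' b'"
  unfolding bisim_def by blast

lemma bisim_back: "bisim R S N \<Longrightarrow> N a b \<Longrightarrow> S b' b \<Longrightarrow> \<exists>a'. R a' a \<and> N a' b'"
  unfolding bisim_def by blast

lemma bisim_converse: "bisim R S N \<Longrightarrow> bisim S R (\<lambda>b a. N a b)"
  unfolding bisim_def by blast

locale universe_pair = left: universe_rel E R + right: universe_rel E S
  for E R S :: "'v \<Rightarrow> 'v \<Rightarrow> bool"
begin

lemmas pair_intros = fodef_intros fodef_subst2[OF left.rel] fodef_subst2[OF right.rel]

lemma bisim_functional:
  assumes N: "left.class_rel N" "bisim R S N" and "N x y" "N x y'"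
  shows "y = y'"
proof -
  have "fodef E (\<lambda>s. \<forall>y y'. N (s 0) y \<longrightarrow> N (s 0) y' \<longrightarrow> y = y')"
    by (intro pair_intros fodef_subst2[OF N(1)])
  then have "\<forall>y y'. N x y \<longrightarrow> N x y' \<longrightarrow> y = y'"
  proof (rule left.class_induct)
    fix x assume IH: "\<And>a. R a x \<Longrightarrow> \<forall>y y'. N a y \<longrightarrow> N a y' \<longrightarrow> y = y'"
    \<comment> \<open>Go back from \<open>b\<close> to some \<open>a\<close> below \<open>x\<close>,
      then forth to some element below \<open>y'\<close>; by \<open>IH\<close> for \<open>a\<close>
      that element is \<open>b\<close>.\<close>
    have "S b y'" if "N x y" "N x y'" "S b y" for b y y'
      using that IH bisim_back[OF N(2)] bisim_forth[OF N(2)] by metis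
    then show "\<forall>y y'. N x y \<longrightarrow> N x y' \<longrightarrow> y = y'"
      using right.rel_ext by metis
  qed
  then show ?thesis using assms(3,4) by blast
qed

definition bisimilar :: "'v \<Rightarrow> 'v \<Rightarrow> bool" where
  "bisimilar x y \<longleftrightarrow> (\<exists>r. left.in_rel r x y \<and> bisim R S (left.in_rel r))"

lemma class_rel_bisimilar: "left.class_rel bisimilar"
  unfolding bisimilar_def bisim_def left.in_rel_def left.is_pair_def left.is_upair_def
  by (intro pair_intros)

lemma bisim_bisimilar: "bisim R S bisimilar"
  unfolding bisim_def bisimilar_def by blast

text \<open>Restricting \<open>N\<close> to a closed set \<open>T\<close> around \<open>x\<close>
  preserves back and forth; as \<open>N\<close> is functional, the restriction is a set.\<close>

lemma bisimilar_maximal: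
  assumes N: "left.class_rel N" "bisim R S N" and "N x y"
  shows "bisimilar x y"
proof -
  obtain T where T: "E x T" "\<And>a a'. E a T \<Longrightarrow> R a' a \<Longrightarrow> E a' T"
    using left.closed_superset by blast
  obtain r where r: "\<And>a b. left.in_rel r a b \<longleftrightarrow> E a T \<and> N a b"
    using left.in_rel_graph[OF N(1), of T] bisim_functional[OF N] by metis
  have "bisim R S (left.in_rel r)"
    using N(2) T(2) unfolding bisim_def r by metis
  moreover have "left.in_rel r x y"
    using T(1) \<open>N x y\<close> r by blast
  ultimately show ?thesis
    unfolding bisimilar_def by blast
qed

lemma bisimilar_total: "\<exists>y. bisimilar x y"
proof -
  have "fodef E (\<lambda>s. \<exists>y. bisimilar (s 0) y)"
    by (intro pair_intros fodef_subst2[OF class_rel_bisimilar])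
  then show ?thesis
  proof (rule left.class_induct)
    fix x assume IH: "\<And>a. R a x \<Longrightarrow> \<exists>b. bisimilar a b"
    obtain A where A: "\<And>a. E a A \<longleftrightarrow> R a x" using left.set_like by blast
    obtain B where B: "\<And>b. E b B \<longleftrightarrow> (\<exists>a. E a A \<and> bisimilar a b)"
      using left.replacement[OF class_rel_bisimilar, of A]
        bisim_functional[OF class_rel_bisimilar bisim_bisimilar] by metis
    obtain y where y: "\<And>b. S b y \<longleftrightarrow> E b B" using right.represented by blast
    \<comment> \<open>The \<open>S\<close>-elements of \<open>y\<close> are the images of the
      \<open>R\<close>-elements of \<open>x\<close>, so adding this pair gives a bisimulation, and
      maximality absorbs it.\<close>
    define N where "N = (\<lambda>a b. bisimilar a b \<or> a = x \<and> b = y)"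
    have "left.class_rel N"
      unfolding N_def by (intro pair_intros fodef_subst2[OF class_rel_bisimilar])
    moreover have "bisim R S N"
    proof -
      have "S b y \<longleftrightarrow> (\<exists>a. R a x \<and> bisimilar a b)" for b
        using y B A by simp
      then show ?thesis
        using bisim_forth[OF bisim_bisimilar] bisim_back[OF bisim_bisimilar] IH
        unfolding bisim_def N_def by fast
    qed
    moreover have "N x y" unfolding N_def by blast
    ultimately show "\<exists>y. bisimilar x y" using bisimilar_maximal by blast
  qed
qed

text \<open>The situation is symmetric in \<open>R\<close> and \<open>S\<close>: functionality and
  totality for the flipped pair give injectivity and surjectivity of
  \<open>bisimilar\<close>.\<close>

theorem universes_isomorphic: "isomorphic R S"
proof -
  interpret flip: universe_pair E S R ..
  have "left.class_rel (\<lambda>b a. bisimilar a b)" "left.class_rel (\<lambda>b a. flip.bisimilar a b)"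
    using fodef_subst2[OF class_rel_bisimilar] fodef_subst2[OF flip.class_rel_bisimilar]
    by (simp_all add: simple_term_var)
  note converse = this bisim_converse[OF bisim_bisimilar] bisim_converse[OF flip.bisim_bisimilar]
  have functional: "y = y'" if "bisimilar x y" "bisimilar x y'" for x y y'
    using bisim_functional[OF class_rel_bisimilar bisim_bisimilar that] .
  have injective: "x = x'" if "bisimilar x y" "bisimilar x' y" for x x' y
    using flip.bisim_functional[OF converse(1,3) that] .
  have surjective: "\<exists>x. bisimilar x y" for y
    using flip.bisimilar_total[of y] bisimilar_maximal[OF converse(2,4)] by blast
  obtain f where f: "\<And>x. bisimilar x (f x)"
    using bisimilar_total by metis
  have "bij f"
    unfolding bij_def inj_def surj_def using f functional injective surjective by metis
  moreover have "R x y \<longleftrightarrow> S (f x) (f y)" for x y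
    using bisim_forth[OF bisim_bisimilar f] bisim_back[OF bisim_bisimilar f] f functional injective
    by metis
  ultimately show ?thesis unfolding isomorphic_def by blast
qed

end

section \<open>From equal inclusions to the isomorphism\<close>

lemma atom_correspondence:
  assumes "zfc_model E" "zfc_model F" and incl: "\<And>u v. inclusion F u v \<longleftrightarrow> inclusion E u v"
  shows "\<exists>b. \<forall>u. E a u \<longleftrightarrow> F b u"
proof -
  interpret E: zfc_model E by fact
  interpret F: zfc_model F by fact
  obtain s where s: "\<And>z. E z s \<longleftrightarrow> z = a \<or> z = a" using E.pairing[of a a] by metis
  obtain e where e: "\<And>z. \<not> E z e" using E.empty_set by blast
  obtain e' where e': "\<And>z. \<not> F z e'" using F.empty_set by blast
  \<comment> \<open>Being least for the common inclusion, \<open>e\<close> is empty for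
    \<open>F\<close> as well.\<close>
  have "inclusion F e e'" using e unfolding incl by (simp add: inclusion_def)
  then have Fe: "\<not> F z e" for z using e' unfolding inclusion_def by blast
  have atom: "u = s \<or> u = e" if "inclusion E u s" for u
    using that E.set_ext[of u s] E.set_ext[of u e] s e unfolding inclusion_def by metis
  have "s \<noteq> e" using s e by blast
  then obtain b where b: "F b s" using F.set_ext[of s e] Fe by blast
  obtain t where t: "\<And>z. F z t \<longleftrightarrow> z = b \<or> z = b" using F.pairing[of b b] by metis
  \<comment> \<open>The \<open>F\<close>-singleton \<open>t\<close> is a nonempty part of the atom
    \<open>s\<close>, so they coincide; membership of \<open>a\<close> or \<open>b\<close> in
    \<open>u\<close> then says that \<open>s\<close> is included in \<open>u\<close>.\<close>
  have "inclusion F t s" using t b by (simp add: inclusion_def)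
  then have "t = s" using atom[of t] t Fe unfolding incl by blast
  then have "E a u \<longleftrightarrow> F b u" for u
    using incl[of s u] s t unfolding inclusion_def by metis
  then show ?thesis by blast
qed

theorem theorem1p5:
  fixes mem mem_star :: "'v \<Rightarrow> 'v \<Rightarrow> bool"
  assumes "models_ZFC mem"
    and "definable_rel mem mem_star"
    and "models_ZFC mem_star"
    and "\<And>u v. inclusion mem_star u v \<longleftrightarrow> inclusion mem u v"
  shows "isomorphic mem mem_star"
proof -
  interpret V: zfc_model mem by unfold_locales fact
  interpret W: zfc_model mem_star by unfold_locales fact
  note star = fodef_definable_rel[OF assms(2)]
  define \<pi> where "\<pi> = (\<lambda>a b. \<forall>u. mem a u \<longleftrightarrow> mem_star b u)"
  have \<pi>_ex: "\<exists>b. \<pi> a b" and \<pi>_ex': "\<exists>a. \<pi> a b" for a b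
    using atom_correspondence[OF V.zfc_model_axioms W.zfc_model_axioms assms(4), of a]
      atom_correspondence[OF W.zfc_model_axioms V.zfc_model_axioms assms(4)[symmetric], of b]
    unfolding \<pi>_def by metis+
  \<comment> \<open>Test both values on the \<open>mem_star\<close>-singleton of
    \<open>b\<close>.\<close>
  have \<pi>_fun: "b = b'" if "\<pi> a b" "\<pi> a b'" for a b b'
    using that W.pairing[of b b] unfolding \<pi>_def by metis
  have \<pi>_inj: "a = a'" if "\<pi> a b" "\<pi> a' b" for a a' b
    using that V.pairing[of a a] unfolding \<pi>_def by metis
  have \<pi>_rel: "V.class_rel \<pi>" "V.class_rel (\<lambda>b a. \<pi> a b)"
    unfolding \<pi>_def by (intro fodef_intros fodef_subst2[OF star])+
  \<comment> \<open>The \<open>\<pi>\<close>-image of \<open>x\<close> consists of the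
    \<open>mem_star\<close>-elements of \<open>x\<close>; dually, \<open>represented\<close> takes
    the preimage of \<open>A\<close>.\<close>
  have set_like: "\<exists>A. \<forall>a. mem a A \<longleftrightarrow> mem_star a x" for x
  proof -
    obtain A where "\<And>b. mem b A \<longleftrightarrow> (\<exists>a. mem a x \<and> \<pi> a b)"
      using V.replacement[OF \<pi>_rel(1), of x] \<pi>_fun by metis
    then show ?thesis using \<pi>_ex' unfolding \<pi>_def by metis
  qed
  have represented: "\<exists>x. \<forall>a. mem_star a x \<longleftrightarrow> mem a A" for A
  proof -
    obtain x where x: "\<And>a. mem a x \<longleftrightarrow> (\<exists>b. mem b A \<and> \<pi> a b)"
      using V.replacement[OF \<pi>_rel(2), of A] \<pi>_inj by metis
    have "mem_star b x \<longleftrightarrow> mem b A" for b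
    proof -
      obtain a where a: "\<pi> a b" using \<pi>_ex' by blast
      then have "mem_star b x \<longleftrightarrow> mem a x" unfolding \<pi>_def by blast
      also have "\<dots> \<longleftrightarrow> mem b A" unfolding x using a \<pi>_fun by blast
      finally show ?thesis .
    qed
    then show ?thesis by blast
  qed
  \<comment> \<open>Foundation for \<open>mem_star\<close> applies to the set whose
    \<open>mem_star\<close>-extension is \<open>A\<close>.\<close>
  have founded: "\<exists>y. mem y A \<and> (\<forall>z. mem_star z y \<longrightarrow> \<not> mem z A)" if "mem x A" for x A
    using that represented[of A] W.foundation by metis
  \<comment> \<open>Both relations are classes over the same model \<open>mem\<close>, the left one
    being \<open>mem\<close> itself.\<close>
  interpret universe_pair mem mem mem_star
  proof unfold_locales
    show "V.class_rel mem" by (intro fodef_intros)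
    show "\<exists>y. mem y A \<and> (\<forall>z. mem z y \<longrightarrow> \<not> mem z A)" if "mem x A" for x A
      using V.foundation[OF that] by blast
  qed (use star set_like represented founded V.set_ext W.set_ext in blast)+
  show ?thesis by (rule universes_isomorphic)
qed

end
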